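(* Let $D$ be a diagram of a non-split link $L$, equipped with a tangle-strand decomposition, and let $\mathcal{IQ}(L,D)$ be the associated coarse presentation of the involutory quandle $IQ(L)$. If $IQ(L)$ is left-orderable, then there exists a non-trivial coarse relation in $\mathcal{IQ}(L,D)$; that is, there is a tangle part $t$ of $D$ such that $X_t\neq Y_t$ in $IQ(L)$.
   Context: **Quandles.** A quandle is a set $Q$ with a binary operation $*$ such that $x*x=x$; for all $x,y$ there is a unique $z$ with $z*y=x$; and $(x*y)*z=(x*z)*(y*z)$. It is involutory if $(x*y)*y=x$ for all $x,y$. A left-order on $Q$ is a strict linear order $<$ such that $x<y$ implies $z*x<z*y$ for all $x,y,z\in Q$. $Q$ is left-orderable if it has a left-order; by convention a trivial quandle (one with $x*y=x$ for all $x,y$), in particular the one-element quandle, is not considered left-orderable. **Involutory quandle of a link.** For a diagram $D$ of a link $L$, let $A(D)$ be its set of arcs. $IQ(L)$ is the involutory quandle with generating set $A(D)$ and, for each crossing with over-arc $y$ and under-arcs $x,z$, the relation $z=x*y$. It is an invariant of the unoriented link $L$. For a set $A$ of arcs, $A_{IQ}$ denotes the set of the corresponding elements of $IQ(L)$; an arc and the corresponding element are denoted by the same letter. **Rational tangles.** Tangle diagrams lie in a disk $\Delta$ with four boundary endpoints $NW,NE,SW,SE$. The tangle $1$ (resp. $-1$) is the single crossing whose over-strand joins $SW$ to $NE$ (resp. $NW$ to $SE$). A rational tangle with fraction $[a_1,\dots,a_n]=a_1+\frac{1}{a_2+\frac{1}{\ddots+\frac{1}{a_n}}}$, where $n$ is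 odd and all nonzero $a_i$ have the same sign (only $a_1$ may be $0$), has as standard diagram the alternating diagram obtained as follows: start with a horizontal row of $|a_n|$ crossings, attach below it a vertical column of $|a_{n-1}|$ crossings, attach to the right a horizontal row of $|a_{n-2}|$ crossings, and so on, ending with a row of $|a_1|$ crossings on the right. All crossings are of type $1$ if the fraction is positive and of type $-1$ if it is negative. Tangle diagrams are assumed connected and reduced. **Tangle-strand decomposition.** Colour the complementary regions of $D$ in checkerboard fashion with the unbounded region uncoloured; the coloured regions (joined by half-twisted bands at the crossings) form the checkerboard surface, with boundary $L$. A tangle-strand decomposition of $D$ is a decomposition of $D$ into embedded rational tangles (standard diagrams in pairwise disjoint disks which together contain all crossings) joined by crossingless strands, which decomposes the checkerboard surface into disks (disk parts) and the subsurfaces lying over the tangle disks (tangle parts). The boundary of the disk $\Delta$ of each tangle part meets the coloured surface in two arcs; the endpoints are named so that one of these arcs joins $NW$ to $SW$ and the other joins $NE$ to $SE$, and with this naming the tangle is a well-defined rational tangle $t$ (the tangle part is also denoted $t$). $A(t)$ is the set of arcs of the tangle $t$ (regarded as arcs of $D$). If $t$ is positive, $X_t$ and $Y_t$ are the arcs through the endpoints $NW$ and $SE$ respectively; if $t$ is negative, they are the arcs through $NE$ and $SW$ respectively. **Coarse presentation.** Let $Q$ be a left-orderable involutory quandle. For $x,y\in Q$ let $[x,y]=\bigcap_{<}\{z\in Q: x\le z\le y\}$, the intersection over all left-orders $<$ on $Q$ with $x\le y$, and let $\{|x,y|\}=[x,y]\cap[y,x]$. The coarse presentation $\mathcal{IQ}(L,D)$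 consists of the generators $A(D)$, the crossing relations, and, for each tangle part $t$, the coarse relation $A_{IQ}(t)\subset\{|X_t,Y_t|\}$. This coarse relation is called trivial if $X_t=Y_t$ in $IQ(L)$, and non-trivial otherwise. *)

theory Defs
  imports Complex_Main "HOL-Library.Numeral_Type"
begin

section \<open>Quandles and left-orders\<close>

locale quandle =
  fixes Q :: "'a set" and qop :: "'a \<Rightarrow> 'a \<Rightarrow> 'a"  (infixl \<open>\<star>\<close> 70)
  assumes closed: "x \<in> Q \<Longrightarrow> y \<in> Q \<Longrightarrow> x \<star> y \<in> Q"
    and idem: "x \<in> Q \<Longrightarrow> x \<star> x = x"
    and right_division: "x \<in> Q \<Longrightarrow> y \<in> Q \<Longrightarrow> \<exists>!z. z \<in> Q \<and> z \<star> y = x"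
    and self_distributive:
      "x \<in> Q \<Longrightarrow> y \<in> Q \<Longrightarrow> z \<in> Q \<Longrightarrow> (x \<star> y) \<star> z = (x \<star> z) \<star> (y \<star> z)"

locale involutory_quandle = quandle +
  assumes involutory: "x \<in> Q \<Longrightarrow> y \<in> Q \<Longrightarrow> (x \<star> y) \<star> y = x"

definition trivial_quandle :: "'a set \<Rightarrow> ('a \<Rightarrow> 'a \<Rightarrow> 'a) \<Rightarrow> bool" where
  "trivial_quandle Q f \<longleftrightarrow> (\<forall>x\<in>Q. \<forall>y\<in>Q. f x y = x)"

definition left_order :: "'a set \<Rightarrow> ('a \<Rightarrow> 'a \<Rightarrow> 'a) \<Rightarrow> ('a \<times> 'a) set \<Rightarrow> bool" where
  "left_order Q f r \<longleftrightarrow> r \<subseteq> Q \<times> Q \<and> strict_linear_order_on Q r \<and>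
     (\<forall>x\<in>Q. \<forall>y\<in>Q. \<forall>z\<in>Q. (x, y) \<in> r \<longrightarrow> (f z x, f z y) \<in> r)"

definition left_orderable :: "'a set \<Rightarrow> ('a \<Rightarrow> 'a \<Rightarrow> 'a) \<Rightarrow> bool" where
  "left_orderable Q f \<longleftrightarrow> \<not> trivial_quandle Q f \<and> (\<exists>r. left_order Q f r)"

text \<open>The sets \<open>[x,y]\<close> and \<open>{|x,y|}\<close>.\<close>

definition order_interval :: "'a set \<Rightarrow> ('a \<Rightarrow> 'a \<Rightarrow> 'a) \<Rightarrow> 'a \<Rightarrow> 'a \<Rightarrow> 'a set" where
  "order_interval Q f x y =
     {z \<in> Q. \<forall>r. left_order Q f r \<and> (x, y) \<in> r\<^sup>= \<longrightarrow> (x, z) \<in> r\<^sup>= \<and> (z, y) \<in> r\<^sup>=}"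

definition coarse_interval :: "'a set \<Rightarrow> ('a \<Rightarrow> 'a \<Rightarrow> 'a) \<Rightarrow> 'a \<Rightarrow> 'a \<Rightarrow> 'a set" where
  "coarse_interval Q f x y = order_interval Q f x y \<inter> order_interval Q f y x"


section \<open>Presentations of involutory quandles\<close>

datatype 'g qterm = Gen 'g | Prod "'g qterm" "'g qterm"

record 'g iq_presentation =
  gens :: "'g set"
  rels :: "('g qterm \<times> 'g qterm) set"

definition qterms :: "('g, 'z) iq_presentation_scheme \<Rightarrow> 'g qterm set" where
  "qterms P = {t. set_qterm t \<subseteq> gens P}"

text \<open>The least congruence on terms containing the relations and all instances of the axioms
  of involutory quandles (unique right division follows from \<open>invol\<close>).\<close>

inductive iq_eq :: "('g, 'z) iq_presentation_scheme \<Rightarrow> 'g qterm \<Rightarrow> 'g qterm \<Rightarrow> bool"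
  for P where
  rel: "(s, t) \<in> rels P \<Longrightarrow> s \<in> qterms P \<Longrightarrow> t \<in> qterms P \<Longrightarrow> iq_eq P s t"
| idem: "s \<in> qterms P \<Longrightarrow> iq_eq P (Prod s s) s"
| invol: "s \<in> qterms P \<Longrightarrow> t \<in> qterms P \<Longrightarrow> iq_eq P (Prod (Prod s t) t) s"
| distrib: "s \<in> qterms P \<Longrightarrow> t \<in> qterms P \<Longrightarrow> u \<in> qterms P \<Longrightarrow>
    iq_eq P (Prod (Prod s t) u) (Prod (Prod s u) (Prod t u))"
| refl: "s \<in> qterms P \<Longrightarrow> iq_eq P s s"
| sym: "iq_eq P s t \<Longrightarrow> iq_eq P t s"
| trans: "iq_eq P s t \<Longrightarrow> iq_eq P t u \<Longrightarrow> iq_eq P s u"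
| cong: "iq_eq P s s' \<Longrightarrow> iq_eq P t t' \<Longrightarrow> iq_eq P (Prod s t) (Prod s' t')"

definition iq_class :: "('g, 'z) iq_presentation_scheme \<Rightarrow> 'g qterm \<Rightarrow> 'g qterm set" where
  "iq_class P t = {s. iq_eq P t s}"

definition iq_carrier :: "('g, 'z) iq_presentation_scheme \<Rightarrow> 'g qterm set set" where
  "iq_carrier P = iq_class P ` qterms P"

definition iq_op ::
    "('g, 'z) iq_presentation_scheme \<Rightarrow> 'g qterm set \<Rightarrow> 'g qterm set \<Rightarrow> 'g qterm set" where
  "iq_op P X Y = (\<Union>s\<in>X. \<Union>t\<in>Y. iq_class P (Prod s t))"

definition iq_gen :: "('g, 'z) iq_presentation_scheme \<Rightarrow> 'g \<Rightarrow> 'g qterm set" where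
  "iq_gen P a = iq_class P (Gen a)"

lemma qterms_Prod [simp]: "Prod s t \<in> qterms P \<longleftrightarrow> s \<in> qterms P \<and> t \<in> qterms P"
  by (auto simp: qterms_def)

lemma iq_eq_qterms: "iq_eq P s t \<Longrightarrow> s \<in> qterms P \<and> t \<in> qterms P"
  by (induction rule: iq_eq.induct) auto

lemma iq_class_eq_iff:
  assumes "s \<in> qterms P"
  shows "iq_class P s = iq_class P t \<longleftrightarrow> iq_eq P s t"
proof
  assume "iq_class P s = iq_class P t"
  moreover have "s \<in> iq_class P s"
    using assms by (simp add: iq_class_def iq_eq.refl)
  ultimately have "iq_eq P t s"
    by (simp add: iq_class_def)
  then show "iq_eq P s t" by (rule iq_eq.sym)
next
  assume "iq_eq P s t"
  then have "iq_eq P s u \<longleftrightarrow> iq_eq P t u" for u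
    by (meson iq_eq.sym iq_eq.trans)
  then show "iq_class P s = iq_class P t"
    by (simp add: iq_class_def)
qed

lemma iq_op_class:
  assumes "s \<in> qterms P" "t \<in> qterms P"
  shows "iq_op P (iq_class P s) (iq_class P t) = iq_class P (Prod s t)"
proof -
  have eq: "iq_class P (Prod s' t') = iq_class P (Prod s t)"
    if "s' \<in> iq_class P s" "t' \<in> iq_class P t" for s' t'
  proof -
    have "iq_eq P (Prod s t) (Prod s' t')"
      using that by (simp add: iq_class_def iq_eq.cong)
    then show ?thesis
      using assms iq_class_eq_iff[of "Prod s t" P "Prod s' t'"] by simp
  qed
  have "s \<in> iq_class P s" "t \<in> iq_class P t"
    using assms by (simp_all add: iq_class_def iq_eq.refl)
  then have "iq_class P (Prod s t) \<subseteq> iq_op P (iq_class P s) (iq_class P t)"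
    unfolding iq_op_def by blast
  moreover have "iq_op P (iq_class P s) (iq_class P t) \<subseteq> iq_class P (Prod s t)"
    unfolding iq_op_def by (intro UN_least) (simp add: eq)
  ultimately show ?thesis by blast
qed

lemma involutory_quandle_iq: "involutory_quandle (iq_carrier P) (iq_op P)"
proof -
  let ?Q = "iq_carrier P" and ?f = "iq_op P"
  have rep: "\<exists>s\<in>qterms P. x = iq_class P s" if "x \<in> ?Q" for x
    using that by (auto simp: iq_carrier_def)
  have cl: "?f x y \<in> ?Q" if "x \<in> ?Q" "y \<in> ?Q" for x y
    using rep[OF that(1)] rep[OF that(2)] by (auto simp: iq_carrier_def iq_op_class)
  have idem: "?f x x = x" if "x \<in> ?Q" for x
    using rep[OF that] by (metis iq_op_class iq_class_eq_iff qterms_Prod iq_eq.idem)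
  have invol: "?f (?f x y) y = x" if xy: "x \<in> ?Q" "y \<in> ?Q" for x y
  proof -
    obtain s t where st: "s \<in> qterms P" "t \<in> qterms P" "x = iq_class P s" "y = iq_class P t"
      using rep xy by meson
    then have "?f (?f x y) y = iq_class P (Prod (Prod s t) t)"
      by (simp add: iq_op_class)
    also have "\<dots> = x"
      using st iq_class_eq_iff[of "Prod (Prod s t) t" P] iq_eq.invol[of s P t] by simp
    finally show ?thesis .
  qed
  have distrib: "?f (?f x y) z = ?f (?f x z) (?f y z)" if xyz: "x \<in> ?Q" "y \<in> ?Q" "z \<in> ?Q"
    for x y z
  proof -
    obtain s t u where st: "s \<in> qterms P" "t \<in> qterms P" "u \<in> qterms P"
      "x = iq_class P s" "y = iq_class P t" "z = iq_class P u"
      using rep xyz by meson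
    then have "?f (?f x y) z = iq_class P (Prod (Prod s t) u)"
      by (simp add: iq_op_class)
    also have "\<dots> = iq_class P (Prod (Prod s u) (Prod t u))"
      using st iq_class_eq_iff[of "Prod (Prod s t) u" P] iq_eq.distrib[of s P t u] by simp
    also have "\<dots> = ?f (?f x z) (?f y z)"
      using st by (simp add: iq_op_class)
    finally show ?thesis .
  qed
  show ?thesis
  proof
    fix x y z assume x: "x \<in> ?Q"
    show "?f x x = x" by (rule idem[OF x])
    assume y: "y \<in> ?Q"
    show "?f x y \<in> ?Q" by (rule cl[OF x y])
    show "?f (?f x y) y = x" by (rule invol[OF x y])
    show "\<exists>!z. z \<in> ?Q \<and> ?f z y = x"
    proof
      show "?f x y \<in> ?Q \<and> ?f (?f x y) y = x" using cl[OF x y] invol[OF x y] by simp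
      fix z assume "z \<in> ?Q \<and> ?f z y = x"
      then show "z = ?f x y" using invol[of z y] y by auto
    qed
    assume z: "z \<in> ?Q"
    show "?f (?f x y) z = ?f (?f x z) (?f y z)" by (rule distrib[OF x y z])
  qed
qed


section \<open>Link diagrams\<close>

text \<open>A diagram is given by its planar diagram code. The four half-edges (darts) at a crossing
  \<open>c\<close> are \<open>(c, i)\<close>, with \<open>i\<close> an integer modulo 4, in counterclockwise order; the under-strand
  runs through the positions 0 and 2, the over-strand through 1 and 3. The edge containing
  the dart \<open>(c, i)\<close> is \<open>pd D c i\<close>. An edge that contains no dart is a component without
  crossings.

  The code describes each connected component of the diagram up to isotopy in the sphere.
  The relative position of the components of a disconnected diagram is not recorded: it does not
  influence the link, which is the split union of the links of the components. A diagram in the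
  plane is a diagram together with the choice of the unbounded region.\<close>

type_synonym dart = "nat \<times> 4"

record link_diagram =
  crossings :: "nat set"
  edges :: "nat set"
  pd :: "nat \<Rightarrow> 4 \<Rightarrow> nat"

definition over :: "4 \<Rightarrow> bool" where
  "over i \<longleftrightarrow> i = 1 \<or> i = 3"

definition darts :: "link_diagram \<Rightarrow> dart set" where
  "darts D = crossings D \<times> UNIV"

definition edge_of :: "link_diagram \<Rightarrow> dart \<Rightarrow> nat" where
  "edge_of D d = pd D (fst d) (snd d)"

definition glue :: "link_diagram \<Rightarrow> dart \<Rightarrow> dart" where
  "glue D d = (THE d'. d' \<in> darts D \<and> d' \<noteq> d \<and> edge_of D d' = edge_of D d)"

text \<open>Regions are described by their boundary walks, as sets of darts: a dart, directed away
  from its crossing, belongs to the region on its left. Thus \<open>face D (c, i)\<close> is the region in the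
  corner between the positions \<open>i\<close> and \<open>i + 1\<close> of \<open>c\<close>.\<close>

definition face_step :: "link_diagram \<Rightarrow> dart \<Rightarrow> dart" where
  "face_step D d = (fst (glue D d), snd (glue D d) - 1)"

definition face :: "link_diagram \<Rightarrow> dart \<Rightarrow> dart set" where
  "face D d = {(face_step D ^^ n) d | n. True}"

definition faces :: "link_diagram \<Rightarrow> dart set set" where
  "faces D = face D ` darts D"

definition crossing_components :: "link_diagram \<Rightarrow> nat set set" where
  "crossing_components D =
     crossings D // {(c, c'). c \<in> crossings D \<and> c' \<in> crossings D \<and> (\<exists>i j. pd D c i = pd D c' j)}\<^sup>*"

text \<open>Planarity (genus 0 for each component) is expressed by Euler's formula: the Euler
  characteristic of a component is at most 2, with equality only for the sphere.\<close>

definition is_link_diagram :: "link_diagram \<Rightarrow> bool" where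
  "is_link_diagram D \<longleftrightarrow>
     finite (crossings D) \<and> finite (edges D) \<and>
     edge_of D ` darts D \<subseteq> edges D \<and>
     (\<forall>e\<in>edges D. card {d \<in> darts D. edge_of D d = e} \<in> {0, 2}) \<and>
     card (crossings D) + card (faces D) =
       card (edge_of D ` darts D) + 2 * card (crossing_components D)"

definition connected_diagram :: "link_diagram \<Rightarrow> bool" where
  "connected_diagram D \<longleftrightarrow>
     (\<forall>e\<in>edges D. \<forall>e'\<in>edges D. (e, e') \<in> {(pd D c i, pd D c j) | c i j. c \<in> crossings D}\<^sup>*)"


section \<open>Links: diagrams up to Reidemeister moves\<close>

text \<open>\<open>D'\<close> is a relabelling of \<open>D\<close>: names of crossings and edges are changed, and at each
  crossing the numbering of the positions may be turned by a half turn.\<close>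

definition relabelling :: "link_diagram \<Rightarrow> link_diagram \<Rightarrow> bool" where
  "relabelling D D' \<longleftrightarrow> (\<exists>f g r.
     bij_betw f (crossings D) (crossings D') \<and> bij_betw g (edges D) (edges D') \<and>
     (\<forall>c\<in>crossings D. r c \<in> {0, 2} \<and> (\<forall>i. pd D' (f c) (i + r c) = g (pd D c i))))"

text \<open>\<open>D'\<close> arises from \<open>D\<close> by deleting the crossings \<open>K\<close> and the edges \<open>F\<close>, and joining the
  pairs of edges in \<open>M\<close>; \<open>\<rho>\<close> maps the remaining edges to the resulting ones.\<close>

definition deletion ::
    "nat set \<Rightarrow> nat set \<Rightarrow> (nat \<times> nat) set \<Rightarrow> link_diagram \<Rightarrow> link_diagram \<Rightarrow> bool" where
  "deletion K F M D D' \<longleftrightarrow>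
     crossings D' = crossings D - K \<and>
     (\<exists>\<rho>. edges D' = \<rho> ` (edges D - F) \<and>
        (\<forall>e\<in>edges D - F. \<forall>e'\<in>edges D - F. \<rho> e = \<rho> e' \<longleftrightarrow> (e, e') \<in> (M \<union> M\<inverse>)\<^sup>*) \<and>
        (\<forall>c\<in>crossings D'. \<forall>i. pd D' c i = \<rho> (pd D c i)))"

text \<open>Removal of a monogon.\<close>

definition reidemeister1 :: "link_diagram \<Rightarrow> link_diagram \<Rightarrow> bool" where
  "reidemeister1 D D' \<longleftrightarrow> (\<exists>c\<in>crossings D. \<exists>i.
     pd D c i = pd D c (i + 1) \<and>
     deletion {c} {pd D c i} {(pd D c (i + 2), pd D c (i + 3))} D D')"

text \<open>Removal of a bigon with corners \<open>(c, i)\<close> and \<open>(c', j)\<close>, one of whose sides lies over the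
  other at both corners.\<close>

definition reidemeister2 :: "link_diagram \<Rightarrow> link_diagram \<Rightarrow> bool" where
  "reidemeister2 D D' \<longleftrightarrow> (\<exists>c\<in>crossings D. \<exists>c'\<in>crossings D. \<exists>i j. c \<noteq> c' \<and>
     pd D c i = pd D c' (j + 1) \<and> pd D c (i + 1) = pd D c' j \<and>
     (over i \<longleftrightarrow> over (j + 1)) \<and>
     deletion {c, c'} {pd D c i, pd D c (i + 1)}
       {(pd D c (i + 2), pd D c' (j + 3)), (pd D c (i + 3), pd D c' (j + 2))} D D')"

text \<open>Inversion of a triangle with corners \<open>(c k, i k)\<close>, where \<open>k\<close> is an integer modulo 3, and
  sides \<open>pd D (c k) (i k)\<close>. The triangle is not alternating, that is, one of the three strands lies
  over the two others and one lies under the two others. Each strand keeps its directions at its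
  two crossings, but passes them in the opposite order.\<close>

definition reidemeister3 :: "link_diagram \<Rightarrow> link_diagram \<Rightarrow> bool" where
  "reidemeister3 D D' \<longleftrightarrow> (\<exists>(c :: 3 \<Rightarrow> nat) (i :: 3 \<Rightarrow> 4).
     inj c \<and> range c \<subseteq> crossings D \<and>
     (\<forall>k. pd D (c k) (i k) = pd D (c (k + 1)) (i (k + 1) + 1)) \<and>
     (\<exists>k l. over (i k) \<and> \<not> over (i l)) \<and>
     crossings D' = crossings D \<and> edges D' = edges D \<and>
     (\<forall>x\<in>crossings D - range c. pd D' x = pd D x) \<and>
     (\<forall>k. pd D' (c k) (i k) = pd D (c (k + 1)) (i (k + 1) + 3) \<and>
          pd D' (c (k + 1)) (i (k + 1) + 1) = pd D (c k) (i k + 2) \<and>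
          pd D' (c k) (i k + 2) = pd D (c k) (i k) \<and>
          pd D' (c k) (i k + 3) = pd D (c k) (i k + 1)))"

definition reidemeister_step :: "(link_diagram \<times> link_diagram) set" where
  "reidemeister_step = {(D, D'). is_link_diagram D \<and> is_link_diagram D' \<and>
     (relabelling D D' \<or> reidemeister1 D D' \<or> reidemeister2 D D' \<or> reidemeister3 D D')}"

text \<open>Two diagrams represent the same unoriented link.\<close>

definition same_link :: "link_diagram \<Rightarrow> link_diagram \<Rightarrow> bool" where
  "same_link D D' \<longleftrightarrow> (D, D') \<in> (reidemeister_step \<union> reidemeister_step\<inverse>)\<^sup>*"

text \<open>The link represented by \<open>D\<close> is split: it has a disconnected diagram.\<close>

definition split_link :: "link_diagram \<Rightarrow> bool" where
  "split_link D \<longleftrightarrow> (\<exists>D'. same_link D D' \<and> \<not> connected_diagram D')"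


section \<open>The involutory quandle of a link\<close>

text \<open>Arcs are sets of edges: the edges met between two consecutive under-crossings.\<close>

definition arc :: "link_diagram \<Rightarrow> nat \<Rightarrow> nat set" where
  "arc D e = ({(pd D c i, pd D c (i + 2)) | c i. c \<in> crossings D \<and> over i}\<^sup>* `` {e})"

definition arcs :: "link_diagram \<Rightarrow> nat set set" where
  "arcs D = arc D ` edges D"

definition crossing_relations :: "link_diagram \<Rightarrow> (nat set qterm \<times> nat set qterm) set" where
  "crossing_relations D =
     {(Gen (arc D (pd D c (i + 2))), Prod (Gen (arc D (pd D c i))) (Gen (arc D (pd D c (i + 1)))))
      | c i. c \<in> crossings D \<and> \<not> over i}"

definition IQ :: "link_diagram \<Rightarrow> nat set iq_presentation" where
  "IQ D = \<lparr>gens = arcs D, rels = crossing_relations D\<rparr>"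


section \<open>Rational tangles\<close>

text \<open>Compass directions, numbered counterclockwise like the positions at a crossing.\<close>

abbreviation (input) NE :: 4 where "NE \<equiv> 0"
abbreviation (input) NW :: 4 where "NW \<equiv> 1"
abbreviation (input) SW :: 4 where "SW \<equiv> 2"
abbreviation (input) SE :: 4 where "SE \<equiv> 3"

text \<open>The combinatorial type of a tangle diagram with crossings \<open>0, \<dots>, tsize - 1\<close>. The half-edge
  \<open>(n, p)\<close> is the one that leaves the crossing \<open>n\<close> in the compass direction \<open>p\<close>. Linked half-edges
  form an edge inside the tangle, and \<open>tend p\<close> is the half-edge ending at the endpoint \<open>p\<close> of
  the tangle.\<close>

record tangle =
  tsize :: nat
  tlinks :: "(dart \<times> dart) set"
  tend :: "4 \<Rightarrow> dart"

definition single_crossing :: tangle where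
  "single_crossing = \<lparr>tsize = 1, tlinks = {}, tend = (\<lambda>p. (0, p))\<rparr>"

definition add_right :: "tangle \<Rightarrow> tangle" where
  "add_right t = (let n = tsize t in
     \<lparr>tsize = n + 1,
      tlinks = tlinks t \<union> {(tend t NE, (n, NW)), (tend t SE, (n, SW))},
      tend = (\<lambda>p. if p = NE \<or> p = SE then (n, p) else tend t p)\<rparr>)"

definition add_below :: "tangle \<Rightarrow> tangle" where
  "add_below t = (let n = tsize t in
     \<lparr>tsize = n + 1,
      tlinks = tlinks t \<union> {(tend t SW, (n, NW)), (tend t SE, (n, NE))},
      tend = (\<lambda>p. if p = SW \<or> p = SE then (n, p) else tend t p)\<rparr>)"

text \<open>The standard diagram (with unspecified crossing type) for \<open>[a\<^sub>1, \<dots>, a\<^sub>n]\<close>, \<open>n\<close> odd: a row of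
  \<open>\<bar>a\<^sub>n\<bar>\<close> crossings, to which alternately columns below and rows to the right are attached.\<close>

fun standard_tangle :: "int list \<Rightarrow> tangle" where
  "standard_tangle [a] = (add_right ^^ (nat \<bar>a\<bar> - 1)) single_crossing"
| "standard_tangle (a # b # as) =
     (add_right ^^ nat \<bar>a\<bar>) ((add_below ^^ nat \<bar>b\<bar>) (standard_tangle as))"

fun continued_fraction :: "int list \<Rightarrow> rat" where
  "continued_fraction [a] = of_int a"
| "continued_fraction (a # as) = of_int a + 1 / continued_fraction as"

text \<open>The sequence \<open>[0]\<close> is excluded since the tangle 0 is not connected; all other
  standard diagrams are connected and reduced.\<close>

definition rational_code :: "int list \<Rightarrow> bool" where
  "rational_code as \<longleftrightarrow>
     odd (length as) \<and> 0 \<notin> set (tl as) \<and>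
     ((\<forall>a\<in>set as. 0 \<le> a) \<or> (\<forall>a\<in>set as. a \<le> 0)) \<and> as \<noteq> [0]"


section \<open>Tangle-strand decompositions\<close>

text \<open>A tangle part of a diagram: the standard diagram for \<open>code\<close> is placed into a disk
  so that its crossing \<open>n\<close> becomes the crossing \<open>emb n\<close>, its compass directions being shifted by
  \<open>rot n\<close> against the numbering of the positions there. The name \<open>p\<close> is given to that
  endpoint of the tangle part which is the endpoint \<open>p + turn\<close> of the standard diagram.\<close>

record tangle_part =
  code :: "int list"
  emb :: "nat \<Rightarrow> nat"
  rot :: "nat \<Rightarrow> 4"
  turn :: 4

definition emb_dart :: "tangle_part \<Rightarrow> dart \<Rightarrow> dart" where
  "emb_dart t d = (emb t (fst d), snd d + rot t (fst d))"

definition part_crossings :: "tangle_part \<Rightarrow> nat set" where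
  "part_crossings t = emb t ` {..<tsize (standard_tangle (code t))}"

definition endpoint :: "tangle_part \<Rightarrow> 4 \<Rightarrow> dart" where
  "endpoint t p = emb_dart t (tend (standard_tangle (code t)) (p + turn t))"

definition inner_darts :: "tangle_part \<Rightarrow> dart set" where
  "inner_darts t = emb_dart t ` Field (tlinks (standard_tangle (code t)))"

text \<open>A quarter turn of a rational tangle with fraction \<open>q\<close> has the fraction \<open>- 1 / q\<close>.\<close>

definition fraction :: "tangle_part \<Rightarrow> rat" where
  "fraction t = (let q = continued_fraction (code t) in
     if turn t = 0 \<or> turn t = 2 then q else - 1 / q)"

text \<open>The crossings are of type 1 (over-strand from SW to NE) if the standard diagram
  has positive fraction and of type -1 (over-strand from NW to SE) otherwise.\<close>

definition is_tangle_part :: "link_diagram \<Rightarrow> tangle_part \<Rightarrow> bool" where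
  "is_tangle_part D t \<longleftrightarrow>
     rational_code (code t) \<and>
     part_crossings t \<subseteq> crossings D \<and>
     inj_on (emb t) {..<tsize (standard_tangle (code t))} \<and>
     (\<forall>n<tsize (standard_tangle (code t)).
        over ((if continued_fraction (code t) > 0 then NE else NW) + rot t n)) \<and>
     (\<forall>(d, d')\<in>tlinks (standard_tangle (code t)).
        edge_of D (emb_dart t d) = edge_of D (emb_dart t d'))"

text \<open>\<open>S\<close> is the set of coloured regions, \<open>outer\<close> is the unbounded region. (Without
  crossings there are no boundary walks and there is nothing to colour.)\<close>

definition checkerboard :: "link_diagram \<Rightarrow> dart set \<Rightarrow> dart set set \<Rightarrow> bool" where
  "checkerboard D outer S \<longleftrightarrow>
     S \<subseteq> faces D \<and> (crossings D \<noteq> {} \<longrightarrow> outer \<in> faces D) \<and> outer \<notin> S \<and>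
     (\<forall>d\<in>darts D. face D d \<in> S \<longleftrightarrow> face D (glue D d) \<notin> S)"

text \<open>The disks around the tangle parts do not contain the unbounded region, and they meet
  the coloured regions between NW and SW and between NE and SE: \<open>endpoint t NW\<close> has the West on its
  left and \<open>endpoint t SE\<close> has the East on its left. The edges outside the tangle parts are the
  crossingless strands. Every region of a connected diagram is an open disk, and the boundaries
  of the tangle disks cut it along chords; so the rest of the checkerboard surface automatically
  consists of disks.\<close>

definition tangle_strand_decomposition ::
    "link_diagram \<Rightarrow> dart set \<Rightarrow> dart set set \<Rightarrow> tangle_part set \<Rightarrow> bool" where
  "tangle_strand_decomposition D outer S T \<longleftrightarrow>
     checkerboard D outer S \<and>
     (\<forall>t\<in>T. is_tangle_part D t \<and> \<not> outer \<subseteq> inner_darts t \<and>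
        face D (endpoint t NW) \<in> S \<and> face D (endpoint t SE) \<in> S) \<and>
     (\<forall>t\<in>T. \<forall>t'\<in>T. t \<noteq> t' \<longrightarrow> part_crossings t \<inter> part_crossings t' = {}) \<and>
     (\<Union>t\<in>T. part_crossings t) = crossings D"


section \<open>The coarse presentation\<close>

definition part_arcs :: "link_diagram \<Rightarrow> tangle_part \<Rightarrow> nat set set" where
  "part_arcs D t = {arc D (pd D c i) | c i. c \<in> part_crossings t}"

definition X_arc :: "link_diagram \<Rightarrow> tangle_part \<Rightarrow> nat set" where
  "X_arc D t = arc D (edge_of D (endpoint t (if fraction t > 0 then NW else NE)))"

definition Y_arc :: "link_diagram \<Rightarrow> tangle_part \<Rightarrow> nat set" where
  "Y_arc D t = arc D (edge_of D (endpoint t (if fraction t > 0 then SE else SW)))"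

text \<open>\<open>Coarse A x y\<close> stands for the coarse relation \<open>A \<subseteq> {|x,y|}\<close>.\<close>

datatype 'g coarse_relation = Coarse "'g set" 'g 'g

record 'g coarse_presentation = "'g iq_presentation" +
  coarse_relations :: "'g coarse_relation set"

definition coarse_IQ :: "link_diagram \<Rightarrow> tangle_part set \<Rightarrow> nat set coarse_presentation" where
  "coarse_IQ D T = \<lparr>gens = arcs D, rels = crossing_relations D,
     coarse_relations = (\<lambda>t. Coarse (part_arcs D t) (X_arc D t) (Y_arc D t)) ` T\<rparr>"

fun coarse_relation_holds ::
    "('g, 'z) iq_presentation_scheme \<Rightarrow> 'g coarse_relation \<Rightarrow> bool" where
  "coarse_relation_holds P (Coarse A x y) \<longleftrightarrow>
     iq_gen P ` A \<subseteq> coarse_interval (iq_carrier P) (iq_op P) (iq_gen P x) (iq_gen P y)"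

fun nontrivial_coarse_relation ::
    "('g, 'z) iq_presentation_scheme \<Rightarrow> 'g coarse_relation \<Rightarrow> bool" where
  "nontrivial_coarse_relation P (Coarse A x y) \<longleftrightarrow> iq_gen P x \<noteq> iq_gen P y"

lemma exists_nontrivial_iff:
  "(\<exists>\<rho>\<in>coarse_relations (coarse_IQ D T). nontrivial_coarse_relation P \<rho>) \<longleftrightarrow>
     (\<exists>t\<in>T. iq_gen P (X_arc D t) \<noteq> iq_gen P (Y_arc D t))"
  by (simp add: coarse_IQ_def)

end

theory Submission
  imports Defs
begin

text \<open>In a left-ordered involutory quandle the three arcs at a crossing form a monotone triple.
  Indeed, if \<open>x < y\<close> then \<open>x = x \<star> x < x \<star> y\<close>; here \<open>x \<star> y < y\<close> is impossible, since it would give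
  \<open>x \<star> y < (x \<star> y) \<star> y = x\<close> in the same way. So the over-arc lies between the two
  under-arcs (\<open>over_arc_between\<close>).

  A standard rational diagram is alternating, and this makes the triples at its crossings fit
  together. Orient the order so that the first crossing is weakly increasing from one end of its
  under-strand to the other. Every crossing attached later meets the old tangle in two endpoints.
  One of them is already extremal among all arcs and becomes the over-strand of the new
  crossing; the other one becomes an under-strand. Hence the third arc of the monotone triple is
  the new extremum, and in the end all arcs lie between the arcs at two diagonally opposite
  endpoints (\<open>colours_between_extreme_endpoints\<close>). These arcs are \<open>X\<^sub>t\<close> and \<open>Y\<^sub>t\<close>
  (\<open>X_Y_arcs_extreme\<close>), so if \<open>X\<^sub>t = Y\<^sub>t\<close> in the quandle, antisymmetry forces all arcs
  of the tangle part to be equal there (\<open>trivial_part_monochromatic\<close>).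

  If this happens for every tangle part, then edges that meet at a crossing represent the same
  element of the quandle. A diagram of a non-split link is connected, so all generators coincide;
  by idempotence the quandle then has at most one element, so it is trivial and not
  left-orderable.\<close>


section \<open>Left-orders and crossings\<close>

lemma left_order_converse: "left_order Q f r \<Longrightarrow> left_order Q f (r\<inverse>)"
  by (auto simp: left_order_def strict_linear_order_on_def trans_def irrefl_def total_on_def)

lemma left_order_antisym:
  assumes "left_order Q f r" "(x, y) \<in> r\<^sup>=" "(y, x) \<in> r\<^sup>="
  shows "x = y"
  using assms unfolding left_order_def strict_linear_order_on_def
  by (auto dest: transD irreflD)

lemma left_order_trans:
  assumes "left_order Q f r" "(x, y) \<in> r\<^sup>=" "(y, z) \<in> r\<^sup>="
  shows "(x, z) \<in> r\<^sup>="
  using assms unfolding left_order_def strict_linear_order_on_def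
  by (auto dest: transD)

lemma left_order_total:
  assumes "left_order Q f r" "x \<in> Q" "y \<in> Q"
  shows "(x, y) \<in> r\<^sup>= \<or> (x, y) \<in> (r\<inverse>)\<^sup>="
  using assms unfolding left_order_def strict_linear_order_on_def total_on_def by blast

context involutory_quandle
begin

lemma over_arc_below:
  assumes r: "left_order Q (\<star>) r" and Q: "x \<in> Q" "y \<in> Q" and "(x, y) \<in> r\<^sup>="
  shows "(y, x \<star> y) \<in> r\<^sup>="
proof (cases "x = y")
  case True
  then show ?thesis using idem Q by simp
next
  case False
  have mono: "(u \<star> v, u \<star> w) \<in> r" if "(v, w) \<in> r" "u \<in> Q" for u v w
    using r that unfolding left_order_def by blast
  have total: "(u, v) \<in> r \<or> u = v \<or> (v, u) \<in> r" if "u \<in> Q" "v \<in> Q" for u v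
    using r that unfolding left_order_def strict_linear_order_on_def total_on_def by blast
  have irrefl: "(u, v) \<in> r \<Longrightarrow> (v, u) \<notin> r" for u v
    using r unfolding left_order_def strict_linear_order_on_def by (meson irreflD transD)
  let ?z = "x \<star> y"
  have z: "?z \<in> Q" "?z \<star> y = x"
    using Q closed involutory by auto
  have "(x, ?z) \<in> r"
    using False assms(4) mono[of x y x] idem Q by auto
  \<comment> \<open>If \<open>x \<star> y < y\<close>, the same step applied to \<open>x \<star> y\<close> shows \<open>x \<star> y < (x \<star> y) \<star> y = x\<close>.\<close>
  moreover have "(?z, x) \<in> r" if "(?z, y) \<in> r"
    using mono[OF that z(1)] z idem by simp
  moreover have "?z \<noteq> y \<or> x = y"
    using z idem Q by metis
  ultimately show ?thesis
    using total[OF z(1) Q(2)] irrefl False by auto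
qed

text \<open>Since \<open>_ \<star> y\<close> exchanges the two under-arcs, passing to the opposite order turns one direction
  of the equivalence into the other.\<close>

lemma over_arc_between:
  assumes r: "left_order Q (\<star>) r" and Q: "x \<in> Q" "y \<in> Q"
  shows "(x, y) \<in> r\<^sup>= \<longleftrightarrow> (y, x \<star> y) \<in> r\<^sup>="
proof
  assume "(y, x \<star> y) \<in> r\<^sup>="
  then have "(x \<star> y, y) \<in> (r\<inverse>)\<^sup>="
    by auto
  then have "(y, x \<star> y \<star> y) \<in> (r\<inverse>)\<^sup>="
    using over_arc_below[OF left_order_converse[OF r]] closed Q by blast
  then show "(x, y) \<in> r\<^sup>="
    using involutory Q by auto
qed (rule over_arc_below[OF assms])

end


section \<open>Ordered colourings of rational tangles\<close>

lemma exhaust_4: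
  fixes p :: 4
  shows "p = 0 \<or> p = 1 \<or> p = 2 \<or> p = 3"
proof (induction p)
  case (of_int z)
  then have "z = 0 \<or> z = 1 \<or> z = 2 \<or> z = 3" by auto
  then show ?case by auto
qed

lemma numerals_mod_4 [simp]: "(4::4) = 0" "(5::4) = 1" "(6::4) = 2"
  by simp_all

lemma standard_tangle_induct [consumes 1, case_names single right below]:
  assumes "odd (length as)"
    and "P single_crossing"
    and "\<And>t. P t \<Longrightarrow> P (add_right t)"
    and "\<And>t. P t \<Longrightarrow> P (add_below t)"
  shows "P (standard_tangle as)"
proof -
  have right: "P ((add_right ^^ n) t)" and below: "P ((add_below ^^ n) t)" if "P t" for n t
    using that assms(3,4) by (induction n) auto
  show ?thesis
    using assms(1) by (induction as rule: standard_tangle.induct) (auto intro: right below assms(2))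
qed

lemma tend_standard_tangle:
  assumes "odd (length as)"
  shows "fst (tend (standard_tangle as) p) < tsize (standard_tangle as)"
proof -
  have "0 < tsize (standard_tangle as) \<and>
      (\<forall>p. fst (tend (standard_tangle as) p) < tsize (standard_tangle as))"
    using assms
    by (induction rule: standard_tangle_induct)
      (auto simp: single_crossing_def add_right_def add_below_def Let_def less_Suc_eq)
  then show ?thesis by blast
qed

lemma tsize_standard_tangle_pos: "odd (length as) \<Longrightarrow> 0 < tsize (standard_tangle as)"
  using tend_standard_tangle by (metis gr_implies_not0 neq0_conv)

text \<open>A colouring of the half-edges of a tangle diagram all of whose crossings have over-strands in
  the direction \<open>v\<close>: \<open>v = NE\<close> for positive and \<open>v = NW\<close> for negative tangles. In both cases
  \<open>v + 1\<close> and \<open>v + 3\<close> are the directions of the under-strand, which allows the two signs to be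
  treated at once. All that remains of the quandle is the betweenness of the over-strand.\<close>

definition ordered_colouring ::
    "('a \<Rightarrow> 'a \<Rightarrow> bool) \<Rightarrow> 4 \<Rightarrow> tangle \<Rightarrow> (dart \<Rightarrow> 'a) \<Rightarrow> bool" where
  "ordered_colouring le v t \<kappa> \<longleftrightarrow>
     (\<forall>n<tsize t. \<kappa> (n, v + 2) = \<kappa> (n, v) \<and>
        (le (\<kappa> (n, v + 1)) (\<kappa> (n, v)) \<longleftrightarrow> le (\<kappa> (n, v)) (\<kappa> (n, v + 3)))) \<and>
     (\<forall>(d, d')\<in>tlinks t. \<kappa> d = \<kappa> d')"

text \<open>Induction over the construction of the diagram. A crossing attached to the right or below
  is glued along two endpoints, one of which has the least or greatest colour so far and continues
  as the new over-strand; the other one has a colour in between and continues as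
  the new under-strand. So the outer end of the under-strand carries the new extreme colour.
  For \<open>v = NE\<close> this is always a new maximum at SE; for \<open>v = NW\<close> it is a new maximum at NE
  if the crossing is attached to the right and a new minimum at SW if it is attached below.\<close>

lemma colours_between_extreme_endpoints:
  assumes "odd (length as)"
    and refl: "\<And>x. le x x"
    and trans: "\<And>x y z. le x y \<Longrightarrow> le y z \<Longrightarrow> le x z"
    and v: "v = NE \<or> v = NW"
    and "ordered_colouring le v (standard_tangle as) \<kappa>"
    and start: "le (\<kappa> (0, v + 1)) (\<kappa> (0, v))"
    and "n < tsize (standard_tangle as)"
  shows "le (\<kappa> (tend (standard_tangle as) (v + 1))) (\<kappa> (n, p)) \<and>
    le (\<kappa> (n, p)) (\<kappa> (tend (standard_tangle as) (v + 3)))"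
proof -
  define between where "between t \<longleftrightarrow> (\<forall>n<tsize t. \<forall>p.
      le (\<kappa> (tend t (v + 1))) (\<kappa> (n, p)) \<and> le (\<kappa> (n, p)) (\<kappa> (tend t (v + 3))))" for t :: tangle
  define inv where "inv t \<longleftrightarrow> 0 < tsize t \<and> (\<forall>p. fst (tend t p) < tsize t) \<and>
      (ordered_colouring le v t \<kappa> \<longrightarrow> between t)" for t :: tangle
  \<comment> \<open>The bounds apply to the colours of the endpoints because these are half-edges at crossings of
    the tangle; this is why the range of \<open>tend\<close> is part of the invariant.\<close>
  have "inv (standard_tangle as)"
    using assms(1)
  proof (induction rule: standard_tangle_induct)
    case single
    have "between single_crossing" if "ordered_colouring le v single_crossing \<kappa>"
    proof -
      have 0: "\<kappa> (0, v + 2) = \<kappa> (0, v)" "le (\<kappa> (0, v)) (\<kappa> (0, v + 3))"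
        using that start by (auto simp: ordered_colouring_def single_crossing_def)
      then have "le (\<kappa> (0, v + 1)) (\<kappa> (0, v + 3))"
        using start trans by blast
      then have "le (\<kappa> (0, v + 1)) (\<kappa> (0, p)) \<and> le (\<kappa> (0, p)) (\<kappa> (0, v + 3))" for p
        using v exhaust_4[of p] start 0 refl by (elim disjE) simp_all
      then show ?thesis
        by (simp add: between_def single_crossing_def)
    qed
    then show ?case
      by (simp add: inv_def single_crossing_def)
  next
    case (right t)
    have "between (add_right t)" if col: "ordered_colouring le v (add_right t) \<kappa>"
    proof -
      let ?n = "tsize t"
      have col': "ordered_colouring le v t \<kappa>"
        using col unfolding ordered_colouring_def by (auto simp: add_right_def Let_def)
      have new: "\<kappa> (?n, NW) = \<kappa> (tend t NE)" "\<kappa> (?n, SW) = \<kappa> (tend t SE)"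
        "\<kappa> (?n, v + 2) = \<kappa> (?n, v)"
        "le (\<kappa> (?n, v + 1)) (\<kappa> (?n, v)) \<longleftrightarrow> le (\<kappa> (?n, v)) (\<kappa> (?n, v + 3))"
        using col unfolding ordered_colouring_def by (auto simp: add_right_def Let_def)
      have old: "le (\<kappa> (tend t (v + 1))) (\<kappa> (n, p))" "le (\<kappa> (n, p)) (\<kappa> (tend t (v + 3)))"
        if "n < ?n" for n p
        using right col' that by (auto simp: inv_def between_def)
      have ends: "le (\<kappa> (tend t (v + 1))) (\<kappa> (tend t p))" "le (\<kappa> (tend t p)) (\<kappa> (tend t (v + 3)))"
        for p
        using old[of "fst (tend t p)" "snd (tend t p)"] right by (auto simp: inv_def)
      have lo: "le (\<kappa> (tend (add_right t) (v + 1))) (\<kappa> (tend t (v + 1)))"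
       and hi: "le (\<kappa> (tend t (v + 3))) (\<kappa> (tend (add_right t) (v + 3)))"
        using v new ends refl by (auto simp: add_right_def Let_def)
      have "le (\<kappa> (?n, v + 1)) (\<kappa> (?n, v)) \<and> le (\<kappa> (?n, v)) (\<kappa> (?n, v + 3))"
        using v new ends by auto
      then have chain: "le (\<kappa> (?n, v + 1)) (\<kappa> (?n, p))" "le (\<kappa> (?n, p)) (\<kappa> (?n, v + 3))" for p
        using v exhaust_4[of p] new(3) refl trans[of "\<kappa> (?n, v + 1)" "\<kappa> (?n, v)" "\<kappa> (?n, v + 3)"]
        by auto
      have "le (\<kappa> (tend (add_right t) (v + 1))) (\<kappa> (?n, v + 1))"
        "le (\<kappa> (?n, v + 3)) (\<kappa> (tend (add_right t) (v + 3)))"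
        using v new(1,2) ends refl by (auto simp: add_right_def Let_def)
      then have "le (\<kappa> (tend (add_right t) (v + 1))) (\<kappa> (?n, p)) \<and>
          le (\<kappa> (?n, p)) (\<kappa> (tend (add_right t) (v + 3)))" for p
        using chain trans by blast
      then show ?thesis
        using trans[OF lo old(1)] trans[OF old(2) hi]
        by (auto simp: between_def add_right_def Let_def less_Suc_eq)
    qed
    then show ?case
      using right by (auto simp: inv_def add_right_def Let_def less_Suc_eq)
  next
    case (below t)
    have "between (add_below t)" if col: "ordered_colouring le v (add_below t) \<kappa>"
    proof -
      let ?n = "tsize t"
      have col': "ordered_colouring le v t \<kappa>"
        using col unfolding ordered_colouring_def by (auto simp: add_below_def Let_def)
      have new: "\<kappa> (?n, NW) = \<kappa> (tend t SW)" "\<kappa> (?n, NE) = \<kappa> (tend t SE)"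
        "\<kappa> (?n, v + 2) = \<kappa> (?n, v)"
        "le (\<kappa> (?n, v + 1)) (\<kappa> (?n, v)) \<longleftrightarrow> le (\<kappa> (?n, v)) (\<kappa> (?n, v + 3))"
        using col unfolding ordered_colouring_def by (auto simp: add_below_def Let_def)
      have old: "le (\<kappa> (tend t (v + 1))) (\<kappa> (n, p))" "le (\<kappa> (n, p)) (\<kappa> (tend t (v + 3)))"
        if "n < ?n" for n p
        using below col' that by (auto simp: inv_def between_def)
      have ends: "le (\<kappa> (tend t (v + 1))) (\<kappa> (tend t p))" "le (\<kappa> (tend t p)) (\<kappa> (tend t (v + 3)))"
        for p
        using old[of "fst (tend t p)" "snd (tend t p)"] below by (auto simp: inv_def)
      have lo: "le (\<kappa> (tend (add_below t) (v + 1))) (\<kappa> (tend t (v + 1)))"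
       and hi: "le (\<kappa> (tend t (v + 3))) (\<kappa> (tend (add_below t) (v + 3)))"
        using v new ends refl by (auto simp: add_below_def Let_def)
      have "le (\<kappa> (?n, v + 1)) (\<kappa> (?n, v)) \<and> le (\<kappa> (?n, v)) (\<kappa> (?n, v + 3))"
        using v new ends by auto
      then have chain: "le (\<kappa> (?n, v + 1)) (\<kappa> (?n, p))" "le (\<kappa> (?n, p)) (\<kappa> (?n, v + 3))" for p
        using v exhaust_4[of p] new(3) refl trans[of "\<kappa> (?n, v + 1)" "\<kappa> (?n, v)" "\<kappa> (?n, v + 3)"]
        by auto
      have "le (\<kappa> (tend (add_below t) (v + 1))) (\<kappa> (?n, v + 1))"
        "le (\<kappa> (?n, v + 3)) (\<kappa> (tend (add_below t) (v + 3)))"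
        using v new(1,2) ends refl by (auto simp: add_below_def Let_def)
      then have "le (\<kappa> (tend (add_below t) (v + 1))) (\<kappa> (?n, p)) \<and>
          le (\<kappa> (?n, p)) (\<kappa> (tend (add_below t) (v + 3)))" for p
        using chain trans by blast
      then show ?thesis
        using trans[OF lo old(1)] trans[OF old(2) hi]
        by (auto simp: between_def add_below_def Let_def less_Suc_eq)
    qed
    then show ?case
      using below by (auto simp: inv_def add_below_def Let_def less_Suc_eq)
  qed
  then show ?thesis
    using assms(5,7) by (simp add: inv_def between_def)
qed


section \<open>The opposite endpoints of a tangle part\<close>

lemma continued_fraction_pos:
  assumes "as \<noteq> []" "\<forall>a\<in>set as. 0 \<le> a" "0 \<notin> set (tl as)" "as \<noteq> [0]"
  shows "0 < continued_fraction as"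
  using assms
proof (induction as rule: continued_fraction.induct)
  case (2 a b as)
  then have "0 < continued_fraction (b # as)"
    by (cases as) auto
  with 2 show ?case
    by (simp add: add_nonneg_pos)
qed auto

lemma continued_fraction_uminus:
  "as \<noteq> [] \<Longrightarrow> continued_fraction (map uminus as) = - continued_fraction as"
  by (induction as rule: continued_fraction.induct) auto

text \<open>The fraction 0 must be excluded because it does not change its sign under
  \<open>q \<mapsto> - 1 / q\<close>: with \<open>1 / 0 = 0\<close>, the choice of \<open>X\<^sub>t\<close> and \<open>Y\<^sub>t\<close> would not follow a quarter turn.\<close>

lemma continued_fraction_nonzero:
  assumes "rational_code as"
  shows "continued_fraction as \<noteq> 0"
proof -
  have as: "as \<noteq> []" "0 \<notin> set (tl as)" "as \<noteq> [0]"
    using assms by (auto simp: rational_code_def)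
  consider "\<forall>a\<in>set as. 0 \<le> a" | "\<forall>a\<in>set as. a \<le> 0"
    using assms by (auto simp: rational_code_def)
  then show ?thesis
  proof cases
    case 1
    then show ?thesis using continued_fraction_pos[OF as(1)] as by simp
  next
    case 2
    have "tl (map uminus as) = map uminus (tl as)"
      by (simp add: map_tl)
    then have "0 \<notin> set (tl (map uminus as))"
      using as(2) by auto
    moreover have "map uminus as \<noteq> [0]"
      using as(3) by (cases as) auto
    ultimately have "0 < continued_fraction (map uminus as)"
      using 2 as(1) by (intro continued_fraction_pos) auto
    then show ?thesis
      using as(1) by (simp add: continued_fraction_uminus)
  qed
qed

text \<open>Compass directions here refer to the standard diagram, before the shifts by \<open>rot\<close> and \<open>turn\<close>.\<close>

definition over_direction :: "tangle_part \<Rightarrow> 4" where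
  "over_direction t = (if continued_fraction (code t) > 0 then NE else NW)"

text \<open>To be used for \<open>p = 1\<close> and \<open>p = 3\<close>, the directions of the under-strands.\<close>

definition extreme_arc :: "link_diagram \<Rightarrow> tangle_part \<Rightarrow> 4 \<Rightarrow> nat set" where
  "extreme_arc D t p =
     arc D (edge_of D (emb_dart t (tend (standard_tangle (code t)) (over_direction t + p))))"

text \<open>A quarter turn changes the sign of the fraction, and with it the choice of the diagonal,
  in the names of the turned tangle, that carries \<open>X\<^sub>t\<close> and \<open>Y\<^sub>t\<close>. So this pair of arcs does not
  depend on the naming of the endpoints.\<close>

lemma X_Y_arcs_extreme:
  assumes "rational_code (code t)"
  shows "{X_arc D t, Y_arc D t} = {extreme_arc D t 1, extreme_arc D t 3}"
proof -
  let ?q = "continued_fraction (code t)"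
  have "?q > 0 \<or> ?q < 0"
    using continued_fraction_nonzero[OF assms] by linarith
  then show ?thesis
    using exhaust_4[of "turn t"]
    by (elim disjE) (simp_all add: X_arc_def Y_arc_def extreme_arc_def endpoint_def fraction_def
        over_direction_def Let_def zero_less_divide_iff insert_commute)
qed


section \<open>Colouring a diagram by its involutory quandle\<close>

definition edge_element :: "link_diagram \<Rightarrow> nat \<Rightarrow> nat set qterm set" where
  "edge_element D e = iq_gen (IQ D) (arc D e)"

lemma add_2_2: "(i::4) + 2 + 2 = i"
  using exhaust_4[of i] by auto

lemma edge_in_edges: "is_link_diagram D \<Longrightarrow> c \<in> crossings D \<Longrightarrow> pd D c i \<in> edges D"
  by (auto simp: is_link_diagram_def darts_def edge_of_def image_subset_iff)

lemma Gen_arc_in_qterms: "e \<in> edges D \<Longrightarrow> Gen (arc D e) \<in> qterms (IQ D)"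
  by (simp add: qterms_def IQ_def arcs_def)

lemma edge_element_in_carrier: "e \<in> edges D \<Longrightarrow> edge_element D e \<in> iq_carrier (IQ D)"
  by (simp add: edge_element_def iq_gen_def iq_carrier_def Gen_arc_in_qterms)

lemma edge_element_over_strand:
  assumes "c \<in> crossings D" "over i"
  shows "edge_element D (pd D c (i + 2)) = edge_element D (pd D c i)"
proof -
  let ?R = "{(pd D c i, pd D c (i + 2)) | c i. c \<in> crossings D \<and> over i}"
  have "over (i + 2)"
    using assms(2) by (auto simp: over_def)
  then have "(pd D c i, pd D c (i + 2)) \<in> ?R" "(pd D c (i + 2), pd D c (i + 2 + 2)) \<in> ?R"
    using assms by blast+
  then have "(pd D c i, pd D c (i + 2)) \<in> ?R\<^sup>*" "(pd D c (i + 2), pd D c i) \<in> ?R\<^sup>*"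
    by (auto simp: add_2_2)
  then have "arc D (pd D c (i + 2)) = arc D (pd D c i)"
    unfolding arc_def by (auto intro: rtrancl_trans)
  then show ?thesis
    by (simp add: edge_element_def)
qed

lemma edge_element_under_strand:
  assumes D: "is_link_diagram D" and c: "c \<in> crossings D" and i: "\<not> over i"
  shows "edge_element D (pd D c (i + 2)) =
    iq_op (IQ D) (edge_element D (pd D c i)) (edge_element D (pd D c (i + 1)))"
proof -
  let ?g = "\<lambda>i. Gen (arc D (pd D c i))"
  have q: "?g j \<in> qterms (IQ D)" for j
    using Gen_arc_in_qterms edge_in_edges D c by blast
  have "(?g (i + 2), Prod (?g i) (?g (i + 1))) \<in> rels (IQ D)"
    using c i by (auto simp: IQ_def crossing_relations_def)
  then have "iq_eq (IQ D) (?g (i + 2)) (Prod (?g i) (?g (i + 1)))"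
    by (rule iq_eq.rel) (simp_all add: q)
  then show ?thesis
    using iq_class_eq_iff[OF q] by (simp add: edge_element_def iq_gen_def iq_op_class q)
qed

text \<open>The under-strand relation, read from direction \<open>v + 1\<close>, has the over-strand as second factor, so
  the betweenness of over-arcs is exactly what an ordered colouring requires.\<close>

lemma edge_element_ordered_colouring:
  assumes D: "is_link_diagram D" and t: "is_tangle_part D t"
    and r: "left_order (iq_carrier (IQ D)) (iq_op (IQ D)) r"
  shows "ordered_colouring (\<lambda>x y. (x, y) \<in> r\<^sup>=) (over_direction t) (standard_tangle (code t))
    (\<lambda>d. edge_element D (edge_of D (emb_dart t d)))"
proof -
  interpret involutory_quandle "iq_carrier (IQ D)" "iq_op (IQ D)"
    by (rule involutory_quandle_iq)
  let ?v = "over_direction t"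
  have crossing: "edge_element D (pd D c (j + 2)) = edge_element D (pd D c j) \<and>
      ((edge_element D (pd D c (j + 1)), edge_element D (pd D c j)) \<in> r\<^sup>= \<longleftrightarrow>
       (edge_element D (pd D c j), edge_element D (pd D c (j + 3))) \<in> r\<^sup>=)"
    if c: "c \<in> crossings D" and j: "over j" for c j
  proof -
    have "\<not> over (j + 1)" "j + 1 + 2 = j + 3" "j + 1 + 1 = j + 2"
      using j by (auto simp: over_def)
    then have "edge_element D (pd D c (j + 3)) =
        iq_op (IQ D) (edge_element D (pd D c (j + 1))) (edge_element D (pd D c j))"
      using edge_element_under_strand[OF D c, of "j + 1"] edge_element_over_strand[OF c j] by metis
    then show ?thesis
      using over_arc_between[OF r] edge_element_in_carrier edge_in_edges[OF D c]
        edge_element_over_strand[OF c j] by metis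
  qed
  have "emb t n \<in> crossings D \<and> over (?v + rot t n)" if "n < tsize (standard_tangle (code t))" for n
    using t that by (auto simp: is_tangle_part_def part_crossings_def over_direction_def)
  then show ?thesis
    using t crossing unfolding ordered_colouring_def is_tangle_part_def
    by (fastforce simp: edge_of_def emb_dart_def ac_simps)
qed

text \<open>Reversing the left-order if necessary, the first crossing is weakly increasing. Then all
  arcs of the part lie between the two extreme ones, which are equal by assumption.\<close>

lemma trivial_part_monochromatic:
  assumes D: "is_link_diagram D" and t: "is_tangle_part D t"
    and "left_order (iq_carrier (IQ D)) (iq_op (IQ D)) r"
    and XY: "iq_gen (IQ D) (X_arc D t) = iq_gen (IQ D) (Y_arc D t)"
    and "c \<in> part_crossings t"
  shows "edge_element D (pd D c i) = iq_gen (IQ D) (X_arc D t)"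
proof -
  let ?t = "standard_tangle (code t)" and ?v = "over_direction t"
  define \<kappa> where "\<kappa> d = edge_element D (edge_of D (emb_dart t d))" for d
  have code: "odd (length (code t))" "rational_code (code t)"
    using t by (auto simp: is_tangle_part_def rational_code_def)
  have "\<kappa> (0, p) \<in> iq_carrier (IQ D)" for p
    using t tsize_standard_tangle_pos[OF code(1)]
    by (auto simp: \<kappa>_def edge_of_def emb_dart_def is_tangle_part_def part_crossings_def
        intro!: edge_element_in_carrier edge_in_edges[OF D])
  then have "(\<kappa> (0, ?v + 1), \<kappa> (0, ?v)) \<in> r\<^sup>= \<or> (\<kappa> (0, ?v + 1), \<kappa> (0, ?v)) \<in> (r\<inverse>)\<^sup>="
    using left_order_total[OF assms(3)] by blast
  then obtain r where r: "left_order (iq_carrier (IQ D)) (iq_op (IQ D)) r"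
    and start: "(\<kappa> (0, ?v + 1), \<kappa> (0, ?v)) \<in> r\<^sup>="
    using assms(3) left_order_converse[OF assms(3)] by metis
  have "ordered_colouring (\<lambda>x y. (x, y) \<in> r\<^sup>=) ?v ?t \<kappa>"
    using edge_element_ordered_colouring[OF D t r] by (simp add: \<kappa>_def[abs_def])
  then have between: "(\<kappa> (tend ?t (?v + 1)), \<kappa> (n, p)) \<in> r\<^sup>= \<and> (\<kappa> (n, p), \<kappa> (tend ?t (?v + 3))) \<in> r\<^sup>="
    if "n < tsize ?t" for n p
    using colours_between_extreme_endpoints[where le = "\<lambda>x y. (x, y) \<in> r\<^sup>=",
        OF code(1) _ left_order_trans[OF r] _ _ start that]
    by (simp add: over_direction_def)
  have "\<kappa> (tend ?t (?v + 1)) = iq_gen (IQ D) (extreme_arc D t 1)"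
    "\<kappa> (tend ?t (?v + 3)) = iq_gen (IQ D) (extreme_arc D t 3)"
    by (simp_all add: \<kappa>_def edge_element_def extreme_arc_def)
  moreover have "iq_gen (IQ D) (extreme_arc D t q) = iq_gen (IQ D) (X_arc D t)" if "q = 1 \<or> q = 3" for q
    using X_Y_arcs_extreme[OF code(2), of D] XY that by (auto simp: doubleton_eq_iff)
  ultimately have const: "\<kappa> (n, p) = iq_gen (IQ D) (X_arc D t)" if "n < tsize ?t" for n p
    using between[OF that] left_order_antisym[OF r] by metis
  obtain n where n: "n < tsize ?t" "c = emb t n"
    using assms(5) by (auto simp: part_crossings_def)
  then have "edge_element D (pd D c i) = \<kappa> (n, i - rot t n)"
    by (simp add: \<kappa>_def edge_of_def emb_dart_def)
  then show ?thesis
    using const n by simp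
qed


section \<open>Connected diagrams with trivial coarse relations\<close>

text \<open>A one-element quandle is reached by collapsing every term bottom-up to a fixed generator, by
  congruence and idempotence. Without generators there are no terms at all.\<close>

lemma trivial_quandle_if_generators_coincide:
  assumes "\<And>a b. a \<in> gens P \<Longrightarrow> b \<in> gens P \<Longrightarrow> iq_gen P a = iq_gen P b"
  shows "trivial_quandle (iq_carrier P) (iq_op P)"
proof -
  have term_eq: "iq_eq P s (Gen a)" if "s \<in> qterms P" "a \<in> gens P" for s a
    using that
  proof (induction s)
    case (Gen b)
    then show ?case
      using assms[of b a] iq_class_eq_iff[of "Gen b" P "Gen a"]
      by (simp add: iq_gen_def qterms_def)
  next
    case (Prod s t)
    then have "iq_eq P (Prod s t) (Prod (Gen a) (Gen a))"
      by (auto intro: iq_eq.cong)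
    moreover have "iq_eq P (Prod (Gen a) (Gen a)) (Gen a)"
      using Prod by (auto intro: iq_eq.idem simp: qterms_def)
    ultimately show ?case
      by (rule iq_eq.trans)
  qed
  have ex: "\<exists>a. a \<in> gens P" if "s \<in> qterms P" for s
    using that by (induction s) (auto simp: qterms_def)
  have "x = y" if xy: "x \<in> iq_carrier P" "y \<in> iq_carrier P" for x y
  proof -
    obtain s s' where s: "s \<in> qterms P" "s' \<in> qterms P" "x = iq_class P s" "y = iq_class P s'"
      using xy by (auto simp: iq_carrier_def)
    then obtain a where "a \<in> gens P"
      using ex by blast
    then have "iq_eq P s s'"
      using s(1,2) term_eq iq_eq.sym iq_eq.trans by meson
    then show ?thesis
      using s by (simp add: iq_class_eq_iff)
  qed
  moreover have "iq_op P x y \<in> iq_carrier P" if "x \<in> iq_carrier P" "y \<in> iq_carrier P" for x y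
    using that by (auto simp: iq_carrier_def iq_op_class)
  ultimately show ?thesis
    unfolding trivial_quandle_def by blast
qed

theorem theorem3p6:
  fixes D :: link_diagram
    and outer :: "dart set"
    and S :: "dart set set"
    and T :: "tangle_part set"
  assumes "is_link_diagram D"
    and "\<not> split_link D"
    and "tangle_strand_decomposition D outer S T"
    and "left_orderable (iq_carrier (IQ D)) (iq_op (IQ D))"
  shows "\<exists>\<rho>\<in>coarse_relations (coarse_IQ D T). nontrivial_coarse_relation (IQ D) \<rho>"
proof (rule ccontr)
  assume "\<not> ?thesis"
  then have XY: "iq_gen (IQ D) (X_arc D t) = iq_gen (IQ D) (Y_arc D t)" if "t \<in> T" for t
    using that by (simp add: exists_nontrivial_iff)
  obtain r where r: "left_order (iq_carrier (IQ D)) (iq_op (IQ D)) r"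
    and nontriv: "\<not> trivial_quandle (iq_carrier (IQ D)) (iq_op (IQ D))"
    using assms(4) by (auto simp: left_orderable_def)
  have at_crossing: "edge_element D (pd D c i) = edge_element D (pd D c j)"
    if c: "c \<in> crossings D" for c i j
  proof -
    obtain t where t: "t \<in> T" "c \<in> part_crossings t" "is_tangle_part D t"
      using assms(3) c unfolding tangle_strand_decomposition_def by blast
    then show ?thesis
      using trivial_part_monochromatic[OF assms(1) t(3) r XY[OF t(1)] t(2)] by simp
  qed
  \<comment> \<open>\<open>D\<close> itself is one of the diagrams of the link.\<close>
  have "connected_diagram D"
    using assms(2) by (auto simp: split_link_def same_link_def)
  then have "(e, e') \<in> {(pd D c i, pd D c j) | c i j. c \<in> crossings D}\<^sup>*"
    if "e \<in> edges D" "e' \<in> edges D" for e e'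
    using that by (auto simp: connected_diagram_def)
  moreover have "edge_element D e = edge_element D e'"
    if "(e, e') \<in> {(pd D c i, pd D c j) | c i j. c \<in> crossings D}\<^sup>*" for e e'
    using that by (induction rule: rtrancl_induct) (auto dest: at_crossing)
  ultimately have "edge_element D e = edge_element D e'" if "e \<in> edges D" "e' \<in> edges D" for e e'
    using that by blast
  moreover have "gens (IQ D) = arc D ` edges D"
    by (simp add: IQ_def arcs_def)
  ultimately have "iq_gen (IQ D) a = iq_gen (IQ D) b" if "a \<in> gens (IQ D)" "b \<in> gens (IQ D)" for a b
    using that unfolding edge_element_def by auto
  then show False
    using trivial_quandle_if_generators_coincide nontriv by blast
qed

end
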